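(* Let $f\colon X\to Z$ be a continuous map. Then $$\mathrm{TC}(f)=\mathrm{TC}(f,\mathrm{id}_Z).$$
   Context: All maps are continuous, $I=[0,1]$, and path spaces $X^I$ carry the compact-open topology. For a map $p\colon E\to B$, the sectional number $\mathrm{sec}(p)$ is the least integer $k\ge 0$ such that $B$ has an open cover $U_0,\dots,U_k$ with continuous maps $s_i\colon U_i\to E$ satisfying $p\circ s_i=\mathrm{inc}_{U_i}$ (strict equality); $\mathrm{sec}(p)=\infty$ if no such $k$ exists. For maps $f\colon X\to Z$, $g\colon Y\to Z$ put $\Delta^I_{f,g}=\{(\alpha,\beta)\in X^I\times Y^I : f\circ\alpha=g\circ\beta\}$ and $\pi_{f,g}\colon\Delta^I_{f,g}\to X\times Y$, $\pi_{f,g}(\alpha,\beta)=(\alpha(0),\beta(1))$. The bivariate topological complexity is $\mathrm{TC}(f,g):=\mathrm{sec}(\pi_{f,g})$. For a single map $f\colon X\to Z$, $\mathrm{TC}(f):=\mathrm{sec}(\pi_f)$, where $\pi_f\colon X^I\to X\times Z$, $\pi_f(\alpha)=(\alpha(0),f(\alpha(1)))$. *)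

theory Defs
  imports "HOL-Analysis.Analysis"
begin

text \<open>
  Spaces are elements of type \<open>'a topology\<close>, so the carrier of a space may be any set, with no
  separation axiom. Elements of a mapping space are required to be extensional
  (\<open>undefined\<close> off \<open>topspace X\<close>), so that each continuous map on \<open>X\<close> is represented exactly once.
\<close>

definition maps_space :: "'a topology \<Rightarrow> 'b topology \<Rightarrow> ('a \<Rightarrow> 'b) set" where
  "maps_space X Y = {f \<in> extensional (topspace X). continuous_map X Y f}"

definition compact_open_topology :: "'a topology \<Rightarrow> 'b topology \<Rightarrow> ('a \<Rightarrow> 'b) topology" where
  "compact_open_topology X Y =
     topology_generated_by {{f \<in> maps_space X Y. f ` K \<subseteq> U} |K U. compactin X K \<and> openin Y U}"

lemma topspace_compact_open_topology: "topspace (compact_open_topology X Y) = maps_space X Y"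
proof -
  have "maps_space X Y = {f \<in> maps_space X Y. f ` {} \<subseteq> {}}"
    by simp
  then have "maps_space X Y \<in> {{f \<in> maps_space X Y. f ` K \<subseteq> U} |K U. compactin X K \<and> openin Y U}"
    using compactin_empty openin_empty by blast
  then show ?thesis
    unfolding compact_open_topology_def topology_generated_by_topspace by blast
qed

definition path_space :: "'a topology \<Rightarrow> (real \<Rightarrow> 'a) topology" where
  "path_space X = compact_open_topology (top_of_set {0..1}) X"

text \<open>The infimum in \<open>enat\<close> of the empty set is \<open>\<infinity>\<close>; the sets of a cover may be empty.\<close>

definition sectional_number :: "'e topology \<Rightarrow> 'b topology \<Rightarrow> ('e \<Rightarrow> 'b) \<Rightarrow> enat" where
  "sectional_number E B p = Inf {enat k |k.
     \<exists>U s. (\<forall>i\<le>k. openin B (U i)) \<and> (\<Union>i\<le>k. U i) = topspace B \<and>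
       (\<forall>i\<le>k. continuous_map (subtopology B (U i)) E (s i) \<and> (\<forall>b\<in>U i. p (s i b) = b))}"

text \<open>
  For \<open>f : X \<rightarrow> Z\<close> and \<open>g : Y \<rightarrow> Z\<close>. The topology of the common codomain \<open>Z\<close> does not enter the
  definition of \<open>\<pi>\<close>; it matters only through the continuity of \<open>f\<close> and \<open>g\<close>.
\<close>

definition path_pairs ::
  "'a topology \<Rightarrow> 'b topology \<Rightarrow> ('a \<Rightarrow> 'c) \<Rightarrow> ('b \<Rightarrow> 'c) \<Rightarrow> ((real \<Rightarrow> 'a) \<times> (real \<Rightarrow> 'b)) topology" where
  "path_pairs X Y f g =
     subtopology (prod_topology (path_space X) (path_space Y))
       {(\<alpha>, \<beta>). \<forall>t\<in>{0..1}. f (\<alpha> t) = g (\<beta> t)}"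

definition bivariate_TC :: "'a topology \<Rightarrow> 'b topology \<Rightarrow> ('a \<Rightarrow> 'c) \<Rightarrow> ('b \<Rightarrow> 'c) \<Rightarrow> enat" where
  "bivariate_TC X Y f g =
     sectional_number (path_pairs X Y f g) (prod_topology X Y) (\<lambda>(\<alpha>, \<beta>). (\<alpha> 0, \<beta> 1))"

definition map_TC :: "'a topology \<Rightarrow> 'c topology \<Rightarrow> ('a \<Rightarrow> 'c) \<Rightarrow> enat" where
  "map_TC X Z f =
     sectional_number (path_space X) (prod_topology X Z) (\<lambda>\<alpha>. (\<alpha> 0, f (\<alpha> 1)))"

end

theory Submission
  imports Defs
begin

text \<open>
  A pair \<open>(\<alpha>, \<beta>)\<close> with \<open>f \<circ> \<alpha> = id \<circ> \<beta>\<close> is determined by \<open>\<alpha>\<close>, and \<open>\<alpha> \<mapsto> (\<alpha>, f \<circ> \<alpha>)\<close> is a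
  homeomorphism from the path space of \<open>X\<close> onto the space of such pairs, with the first projection
  as its inverse; it is continuous because postcomposition with \<open>f\<close> is continuous in the
  compact-open topology (\<open>continuous_map_postcompose\<close>). Both directions commute with the maps to
  \<open>X \<times> Z\<close>, since \<open>\<beta> 1 = f (\<alpha> 1)\<close>. A fibrewise map carries local sections to local sections, so it
  can only lower the sectional number (\<open>sectional_number_le_of_fibrewise_map\<close>), and the two
  directions give the two inequalities.
\<close>

lemma sectional_number_le_of_fibrewise_map:
  assumes h: "continuous_map E E' h"
    and fib: "\<And>e. e \<in> topspace E \<Longrightarrow> p' (h e) = p e"
  shows "sectional_number E' B p' \<le> sectional_number E B p"
  unfolding sectional_number_def
proof (rule Inf_superset_mono, clarify)
  fix k :: nat and U and s
  assume op: "\<forall>i\<le>k. openin B (U i)" and cov: "(\<Union>i\<le>k. U i) = topspace B"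
    and s: "\<forall>i\<le>k. continuous_map (subtopology B (U i)) E (s i) \<and> (\<forall>b\<in>U i. p (s i b) = b)"
  have "continuous_map (subtopology B (U i)) E' (h \<circ> s i) \<and> (\<forall>b\<in>U i. p' ((h \<circ> s i) b) = b)"
    if i: "i \<le> k" for i
  proof (intro conjI ballI)
    have si: "continuous_map (subtopology B (U i)) E (s i)" using s i by blast
    then show "continuous_map (subtopology B (U i)) E' (h \<circ> s i)"
      using h by (rule continuous_map_compose)
    fix b assume b: "b \<in> U i"
    then have "b \<in> topspace (subtopology B (U i))" using cov i by auto
    then have "s i b \<in> topspace E" using si by (auto simp: continuous_map_def)
    then show "p' ((h \<circ> s i) b) = b" using fib s i b by simp
  qed
  then show "\<exists>k'. enat k = enat k' \<and> (\<exists>U s. (\<forall>i\<le>k'. openin B (U i)) \<and> (\<Union>i\<le>k'. U i) = topspace B \<and>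
      (\<forall>i\<le>k'. continuous_map (subtopology B (U i)) E' (s i) \<and> (\<forall>b\<in>U i. p' (s i b) = b)))"
    using op cov by (intro exI[of _ k] conjI refl exI[of _ U] exI[of _ "\<lambda>i. h \<circ> s i"]) auto
qed

text \<open>The restriction makes the composite extensional, as membership in a mapping space requires.\<close>

lemma restrict_compose_in_maps_space:
  assumes "continuous_map Y Z f" "a \<in> maps_space X Y"
  shows "restrict (f \<circ> a) (topspace X) \<in> maps_space X Z"
proof -
  have "continuous_map X Z (f \<circ> a)"
    using assms by (auto simp: maps_space_def intro: continuous_map_compose)
  then have "continuous_map X Z (restrict (f \<circ> a) (topspace X))"
    by (rule continuous_map_eq) simp
  then show ?thesis by (simp add: maps_space_def)
qed

lemma continuous_map_postcompose:
  assumes f: "continuous_map Y Z f"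
  shows "continuous_map (compact_open_topology X Y) (compact_open_topology X Z)
           (\<lambda>a. restrict (f \<circ> a) (topspace X))" (is "continuous_map ?T _ ?h")
proof -
  let ?S = "{{a \<in> maps_space X Z. a ` K \<subseteq> U} |K U. compactin X K \<and> openin Z U}"
  have "openin ?T (?h -` V \<inter> topspace ?T)" if VS: "V \<in> ?S" for V
  proof -
    obtain K U where V: "V = {a \<in> maps_space X Z. a ` K \<subseteq> U}"
      and K: "compactin X K" and U: "openin Z U"
      using VS by blast
    have KX: "K \<subseteq> topspace X" using K by (rule compactin_subset_topspace)
    \<comment> \<open>The preimage of the subbasic set of \<open>K\<close> and \<open>U\<close> is that of \<open>K\<close> and the preimage of \<open>U\<close>.\<close>
    let ?V = "{y \<in> topspace Y. f y \<in> U}"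
    have "?h a \<in> V \<longleftrightarrow> a ` K \<subseteq> ?V" if a: "a \<in> maps_space X Y" for a
    proof -
      have "a x \<in> topspace Y" if "x \<in> K" for x
        using a KX that by (auto simp: maps_space_def continuous_map_def)
      then show ?thesis
        using KX restrict_compose_in_maps_space[OF f a] unfolding V by fastforce
    qed
    then have eq: "?h -` V \<inter> topspace ?T = {a \<in> maps_space X Y. a ` K \<subseteq> ?V}"
      by (auto simp: topspace_compact_open_topology)
    have "openin Y ?V" using f U by (rule openin_continuous_map_preimage)
    then show ?thesis
      unfolding eq unfolding compact_open_topology_def using K
      by (intro topology_generated_by_Basis) blast
  qed
  moreover have "?h ` topspace ?T \<subseteq> \<Union> ?S"
  proof -
    have "?h ` topspace ?T \<subseteq> topspace (compact_open_topology X Z)"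
      using restrict_compose_in_maps_space[OF f] by (auto simp: topspace_compact_open_topology)
    then show ?thesis
      by (simp only: compact_open_topology_def topology_generated_by_topspace)
  qed
  ultimately show ?thesis
    unfolding compact_open_topology_def[of X Z] continuous_on_generated_topo_iff by blast
qed

theorem proposition2p5:
  fixes X :: "'a topology" and Z :: "'b topology" and f :: "'a \<Rightarrow> 'b"
  assumes "continuous_map X Z f"
  shows "map_TC X Z f = bivariate_TC X Z f id"
proof (rule antisym)
  let ?P = "path_pairs X Z f id"
  have fst_cont: "continuous_map ?P (path_space X) fst"
    unfolding path_pairs_def by (intro continuous_map_from_subtopology continuous_map_fst)
  have fst_fib: "(\<lambda>\<alpha>. (\<alpha> 0, f (\<alpha> 1))) (fst e) = (\<lambda>(\<alpha>, \<beta>). (\<alpha> 0, \<beta> 1)) e"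
    if "e \<in> topspace ?P" for e
    using that by (auto simp: path_pairs_def)
  show "map_TC X Z f \<le> bivariate_TC X Z f id"
    unfolding map_TC_def bivariate_TC_def
    by (rule sectional_number_le_of_fibrewise_map[OF fst_cont]) (rule fst_fib)
  let ?h = "\<lambda>\<alpha>. (\<alpha>, restrict (f \<circ> \<alpha>) {0..1::real})"
  have "continuous_map (path_space X) (path_space Z) (\<lambda>\<alpha>. restrict (f \<circ> \<alpha>) {0..1})"
    using continuous_map_postcompose[OF assms, of "top_of_set {0..1::real}"]
    by (simp add: path_space_def)
  then have graph_cont: "continuous_map (path_space X) ?P ?h"
    unfolding path_pairs_def
    by (intro continuous_map_into_subtopology) (auto simp: continuous_map_pairwise o_def)
  show "bivariate_TC X Z f id \<le> map_TC X Z f"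
    unfolding map_TC_def bivariate_TC_def
    by (rule sectional_number_le_of_fibrewise_map[OF graph_cont]) simp
qed

end
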